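(* Let $k\ge 7$ be an integer and let $n\in \mathbb{Z}\setminus\{0\}$. Assume the Lander--Parkin--Selfridge conjecture. Then $M_k(n)\le 5$.
   Context: A set $A$ of positive integers has property $D_k(n)$ if $ab+n$ is a $k$-th power of a nonnegative integer for all distinct $a,b\in A$. Define $M_k(n)=\sup\{|A| : A\subseteq\mathbb{N} \text{ satisfies property } D_k(n)\}$, where $\mathbb{N}$ denotes the positive integers. The Lander--Parkin--Selfridge conjecture is the following assertion: for all positive integers $r,s,k$, if $\sum_{i=1}^{r} a_i^k=\sum_{j=1}^{s} b_j^k$, where $a_1,\ldots,a_r,b_1,\ldots,b_s$ are positive integers such that $a_i\neq b_j$ for all $1\le i\le r$ and $1\le j\le s$, then $r+s\ge k$. It is a hypothesis of the theorem. *)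

theory Defs
  imports Main "HOL-Library.Extended_Nat"
begin

definition has_property_D :: "nat \<Rightarrow> int \<Rightarrow> nat set \<Rightarrow> bool" where
  "has_property_D k n A \<longleftrightarrow>
     (\<forall>a\<in>A. 0 < a) \<and>
     (\<forall>a\<in>A. \<forall>b\<in>A. a \<noteq> b \<longrightarrow> (\<exists>x::nat. int a * int b + n = int x ^ k))"

text \<open>\<^const>\<open>card\<close> sends infinite sets to 0; here they have size \<^term>\<open>\<infinity> :: enat\<close>.\<close>

definition ecard :: "'a set \<Rightarrow> enat" where
  "ecard A = (if finite A then enat (card A) else \<infinity>)"

definition M :: "nat \<Rightarrow> int \<Rightarrow> enat" where
  "M k n = (SUP A \<in> {A. has_property_D k n A}. ecard A)"

definition Lander_Parkin_Selfridge :: bool where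
  "Lander_Parkin_Selfridge \<longleftrightarrow>
     (\<forall>(r::nat) (s::nat) (k::nat) (a::nat \<Rightarrow> nat) (b::nat \<Rightarrow> nat).
        0 < r \<longrightarrow> 0 < s \<longrightarrow> 0 < k \<longrightarrow>
        (\<forall>i\<in>{1..r}. 0 < a i) \<longrightarrow> (\<forall>j\<in>{1..s}. 0 < b j) \<longrightarrow>
        (\<forall>i\<in>{1..r}. \<forall>j\<in>{1..s}. a i \<noteq> b j) \<longrightarrow>
        (\<Sum>i=1..r. a i ^ k) = (\<Sum>j=1..s. b j ^ k) \<longrightarrow>
        k \<le> r + s)"

end

theory Submission
  imports Defs
begin

text \<open>
  Write \<open>a b + n = x\<^sub>a\<^sub>b ^ k\<close>. For six elements \<open>a, b, c, d, e, f\<close> the \<open>3 \<times> 3\<close> matrix of the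
  \<open>k\<close>-th powers with rows \<open>a, b, c\<close> and columns \<open>d, e, f\<close> is a rank one matrix plus \<open>n\<close> times the
  all-ones matrix, so its determinant vanishes. This is an equality between two sums of three
  \<open>k\<close>-th powers. An even and an odd permutation of three points agree in exactly one place, so a
  common nonzero term on both sides would make a \<open>2 \<times> 2\<close> minor vanish; but these minors equal
  \<open>n (a - b) (d - e)\<close> up to sign. Hence the conjecture gives \<open>k \<le> 6\<close>, unless all six terms are
  zero, which is impossible since every row and column contains at most one zero.
\<close>

text \<open>Bridges the indices of lists, which start at 0, and the sums of the conjecture, which
  start at 1.\<close>

lemma sum_list_eq_sum_nth_pred:
  fixes f :: "'a \<Rightarrow> 'b::comm_monoid_add"
  shows "(\<Sum>x\<leftarrow>xs. f x) = (\<Sum>i=1..length xs. f (xs ! (i - 1)))"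
proof -
  have "(\<Sum>x\<leftarrow>xs. f x) = (\<Sum>i<length xs. f (xs ! i))"
    by (simp add: sum_list_sum_nth atLeast0LessThan)
  also have "\<dots> = (\<Sum>i=1..length xs. f (xs ! (i - 1)))"
    by (rule sum.reindex_bij_witness[of _ "\<lambda>i. i - 1" Suc]) auto
  finally show ?thesis .
qed

text \<open>Determinant terms may vanish, but the conjecture wants positive ones, so zeros are
  filtered out. A nonzero entry of \<open>xs\<close> makes both filtered lists nonempty, and the
  conjecture then contradicts the length bound.\<close>

lemma Lander_Parkin_Selfridge_lists:
  fixes xs ys :: "nat list"
  assumes LPS: Lander_Parkin_Selfridge
    and k: "0 < k" "length xs + length ys < k"
    and disj: "set xs \<inter> set ys \<subseteq> {0}"
    and eq: "(\<Sum>x\<leftarrow>xs. x ^ k) = (\<Sum>y\<leftarrow>ys. y ^ k)"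
  shows "set xs \<subseteq> {0}"
proof (rule ccontr)
  assume not: "\<not> set xs \<subseteq> {0}"
  define us where "us = filter (\<lambda>x. 0 < x) xs"
  define vs where "vs = filter (\<lambda>x. 0 < x) ys"
  \<comment> \<open>Here \<open>0 < k\<close> matters: it gives \<open>0 ^ k = 0\<close>.\<close>
  have drop0: "(\<Sum>x\<leftarrow>filter (\<lambda>x. 0 < x) zs. x ^ k) = (\<Sum>x\<leftarrow>zs. x ^ k)" for zs :: "nat list"
    using k by (induction zs) auto
  have eq': "(\<Sum>x\<leftarrow>us. x ^ k) = (\<Sum>y\<leftarrow>vs. y ^ k)"
    using eq by (simp add: us_def vs_def drop0)
  obtain u where "u \<in> set xs" "u \<noteq> 0"
    using not by blast
  then have u: "u \<in> set us"
    by (simp add: us_def)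
  then have "(\<Sum>x\<leftarrow>us. x ^ k) \<noteq> 0"
    by (auto simp: us_def)
  then have "vs \<noteq> []"
    using eq' by auto
  have "us \<noteq> []"
    using u by auto
  have mem: "us ! (i - 1) \<in> set us" if "i \<in> {1..length us}" for i
    using that by (intro nth_mem) auto
  have mem': "vs ! (j - 1) \<in> set vs" if "j \<in> {1..length vs}" for j
    using that by (intro nth_mem) auto
  have pos: "\<And>u. u \<in> set us \<Longrightarrow> 0 < u" "\<And>v. v \<in> set vs \<Longrightarrow> 0 < v"
    and neq: "\<And>u v. \<lbrakk>u \<in> set us; v \<in> set vs\<rbrakk> \<Longrightarrow> u \<noteq> v"
    using disj by (auto simp: us_def vs_def)
  have "k \<le> length us + length vs"
  proof (rule LPS[unfolded Lander_Parkin_Selfridge_def, rule_format])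
    show "0 < length us" "0 < length vs"
      using \<open>us \<noteq> []\<close> \<open>vs \<noteq> []\<close> by simp_all
    show "(\<Sum>i=1..length us. (us ! (i - 1)) ^ k) = (\<Sum>j=1..length vs. (vs ! (j - 1)) ^ k)"
      using eq' by (simp only: sum_list_eq_sum_nth_pred)
  qed (use k(1) mem mem' pos neq in blast)+
  moreover have "length us \<le> length xs" "length vs \<le> length ys"
    by (simp_all add: us_def vs_def)
  ultimately show False
    using k(2) by linarith
qed

lemma det3_terms_disjoint:
  fixes p q r s t u v w z :: nat
  assumes "p * t \<noteq> q * s" "p * u \<noteq> r * s" "q * u \<noteq> r * t"
    and "p * w \<noteq> q * v" "p * z \<noteq> r * v" "q * z \<noteq> r * w"
    and "s * w \<noteq> t * v" "s * z \<noteq> u * v" "t * z \<noteq> u * w"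
  shows "set [p * t * z, q * u * v, r * s * w] \<inter> set [p * u * w, q * s * z, r * t * v] \<subseteq> {0}"
proof -
  have disj: "X \<inter> Y \<subseteq> {0}" if "\<forall>i\<in>X. \<forall>j\<in>Y. i \<noteq> j \<or> i = 0" for X Y :: "nat set"
    using that by blast
  have cancel: "m * i = 0" if "m * i = m * j" "i \<noteq> j" for m i j :: nat
    using that by simp
  \<comment> \<open>Each pair of an even and an odd term is written with its common entry in front.
    If that entry is nonzero, cancelling it yields an equality excluded by one of the nine
    assumptions.\<close>
  have
    "p * (t * z) = p * (u * w) \<Longrightarrow> p * (t * z) = 0"
    "z * (p * t) = z * (q * s) \<Longrightarrow> z * (p * t) = 0"
    "t * (p * z) = t * (r * v) \<Longrightarrow> t * (p * z) = 0"
    "u * (q * v) = u * (p * w) \<Longrightarrow> u * (q * v) = 0"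
    "q * (u * v) = q * (s * z) \<Longrightarrow> q * (u * v) = 0"
    "v * (q * u) = v * (r * t) \<Longrightarrow> v * (q * u) = 0"
    "w * (r * s) = w * (p * u) \<Longrightarrow> w * (r * s) = 0"
    "s * (r * w) = s * (q * z) \<Longrightarrow> s * (r * w) = 0"
    "r * (s * w) = r * (t * v) \<Longrightarrow> r * (s * w) = 0"
    using assms by (metis cancel)+
  then have "\<forall>i\<in>set [p * t * z, q * u * v, r * s * w].
      \<forall>j\<in>set [p * u * w, q * s * z, r * t * v]. i \<noteq> j \<or> i = 0"
    by (simp only: set_simps ball_simps(5,7) ac_simps simp_thms) argo
  then show ?thesis
    by (rule disj)
qed

text \<open>With at most one zero in each row and column, all zeros lie on the graph of a single
  permutation. Another permutation of the same parity agrees with it nowhere, so its term is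
  nonzero.\<close>

lemma det3_term_nonzero:
  fixes p q r s t u v w z :: nat
  assumes "p \<noteq> 0 \<or> q \<noteq> 0" "p \<noteq> 0 \<or> r \<noteq> 0" "q \<noteq> 0 \<or> r \<noteq> 0"
    and "s \<noteq> 0 \<or> t \<noteq> 0" "s \<noteq> 0 \<or> u \<noteq> 0" "t \<noteq> 0 \<or> u \<noteq> 0"
    and "v \<noteq> 0 \<or> w \<noteq> 0" "v \<noteq> 0 \<or> z \<noteq> 0" "w \<noteq> 0 \<or> z \<noteq> 0"
    and "p \<noteq> 0 \<or> s \<noteq> 0" "p \<noteq> 0 \<or> v \<noteq> 0" "s \<noteq> 0 \<or> v \<noteq> 0"
    and "q \<noteq> 0 \<or> t \<noteq> 0" "q \<noteq> 0 \<or> w \<noteq> 0" "t \<noteq> 0 \<or> w \<noteq> 0"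
    and "r \<noteq> 0 \<or> u \<noteq> 0" "r \<noteq> 0 \<or> z \<noteq> 0" "u \<noteq> 0 \<or> z \<noteq> 0"
  shows "\<not> (set [p * t * z, q * u * v, r * s * w] \<subseteq> {0} \<and>
    set [p * u * w, q * s * z, r * t * v] \<subseteq> {0})"
  using assms by (simp del: neq0_conv) argo

text \<open>Stated for the roots, since the conjecture compares bases. After taking
  \<open>k\<close>-th powers, the two sides differ by \<open>n * (a - b) * (c - d)\<close>.\<close>

lemma mixed_products_neq:
  fixes a b c d xac xad xbc xbd :: nat and n :: int
  assumes "n \<noteq> 0" "a \<noteq> b" "c \<noteq> d"
    and ac: "int a * int c + n = int xac ^ k" and ad: "int a * int d + n = int xad ^ k"
    and bc: "int b * int c + n = int xbc ^ k" and bd: "int b * int d + n = int xbd ^ k"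
  shows "xac * xbd \<noteq> xad * xbc"
proof
  assume "xac * xbd = xad * xbc"
  then have "int xac ^ k * int xbd ^ k = int xad ^ k * int xbc ^ k"
    by (metis of_nat_mult power_mult_distrib)
  then have "(int a * int c + n) * (int b * int d + n) = (int a * int d + n) * (int b * int c + n)"
    by (simp add: ac ad bc bd)
  then have "n * (int a - int b) * (int c - int d) = 0"
    by (simp add: algebra_simps)
  then show False
    using assms(1-3) by simp
qed

lemma not_six_elements:
  fixes k :: nat and n :: int
  assumes k: "k \<ge> 7" and n: "n \<noteq> 0"
    and LPS: Lander_Parkin_Selfridge
    and D: "has_property_D k n A"
    and sub: "set [a, b, c, d, e, f] \<subseteq> A"
    and dist: "distinct [a, b, c, d, e, f]"
  shows False
proof -
  from D have "\<forall>a\<in>A. \<forall>b\<in>A. \<exists>x::nat. a \<noteq> b \<longrightarrow> int a * int b + n = int x ^ k"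
    unfolding has_property_D_def by blast
  then obtain x :: "nat \<Rightarrow> nat \<Rightarrow> nat"
    where x: "\<And>a b. \<lbrakk>a \<in> A; b \<in> A; a \<noteq> b\<rbrakk> \<Longrightarrow> int a * int b + n = int (x a b) ^ k"
    by metis
  have pos: "0 < u" if "u \<in> A" for u
    using D that by (auto simp: has_property_D_def)
  let ?R = "{a, b, c}" and ?C = "{d, e, f}"
  have RC: "u \<in> A \<and> v \<in> A \<and> u \<noteq> v" if "u \<in> ?R" "v \<in> ?C" for u v
    using sub dist that by auto
  have minor: "x u v * x u' v' \<noteq> x u v' * x u' v"
    if "u \<in> ?R" "u' \<in> ?R" "v \<in> ?C" "v' \<in> ?C" "u \<noteq> u'" "v \<noteq> v'" for u u' v v'
    by (rule mixed_products_neq[OF n that(5,6)]; rule x) (use RC that in blast)+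
  \<comment> \<open>Two zeros in one row would force \<open>u * v = u * v'\<close> with
    \<open>u\<close> positive.\<close>
  have row: "x u v \<noteq> 0 \<or> x u v' \<noteq> 0" if "u \<in> ?R" "v \<in> ?C" "v' \<in> ?C" "v \<noteq> v'" for u v v'
  proof (rule ccontr)
    assume "\<not> (x u v \<noteq> 0 \<or> x u v' \<noteq> 0)"
    then have "int u * int v + n = int u * int v' + n"
      using x[of u v] x[of u v'] RC that by metis
    then show False
      using pos[of u] RC[of u v] that by auto
  qed
  have col: "x u v \<noteq> 0 \<or> x u' v \<noteq> 0" if "u \<in> ?R" "u' \<in> ?R" "v \<in> ?C" "u \<noteq> u'" for u u' v
  proof (rule ccontr)
    assume "\<not> (x u v \<noteq> 0 \<or> x u' v \<noteq> 0)"
    then have "int u * int v + n = int u' * int v + n"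
      using x[of u v] x[of u' v] RC that by metis
    then show False
      using pos[of v] RC[of u v] that by auto
  qed
  let ?even = "[x a d * x b e * x c f, x a e * x b f * x c d, x a f * x b d * x c e]"
  let ?odd = "[x a d * x b f * x c e, x a e * x b d * x c f, x a f * x b e * x c d]"
  have disj: "set ?even \<inter> set ?odd \<subseteq> {0}"
    by (rule det3_terms_disjoint; rule minor) (use dist in auto)
  have pw: "int (x u v) ^ k = int u * int v + n" if "u \<in> ?R" "v \<in> ?C" for u v
    using x[of u v] RC[OF that] by simp
  \<comment> \<open>This is the vanishing of the determinant with entries
    \<open>u * v + n\<close>.\<close>
  have "int (\<Sum>p\<leftarrow>?even. p ^ k) = int (\<Sum>p\<leftarrow>?odd. p ^ k)"
    by (simp add: power_mult_distrib pw algebra_simps)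
  then have eq: "(\<Sum>p\<leftarrow>?even. p ^ k) = (\<Sum>p\<leftarrow>?odd. p ^ k)"
    by (simp only: of_nat_eq_iff)
  have "set ?even \<subseteq> {0}"
    by (rule Lander_Parkin_Selfridge_lists[OF LPS _ _ disj eq]) (use k in auto)
  \<comment> \<open>The list lemma only concludes about its first list, so the two sides are
    exchanged.\<close>
  moreover have "set ?odd \<subseteq> {0}"
    by (rule Lander_Parkin_Selfridge_lists[OF LPS _ _ _ eq[symmetric]]) (use k disj in auto)
  moreover have "\<not> (set ?even \<subseteq> {0} \<and> set ?odd \<subseteq> {0})"
    by (rule det3_term_nonzero; (rule row | rule col)) (use dist in auto)
  ultimately show False
    by blast
qed

theorem theorem2p2:
  fixes k :: nat and n :: int
  assumes "k \<ge> 7" and "n \<noteq> 0"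
    and "Lander_Parkin_Selfridge"
  shows "M k n \<le> 5"
  unfolding M_def
proof (rule SUP_least, rule ccontr)
  fix A
  assume "A \<in> {A. has_property_D k n A}" and large: "\<not> ecard A \<le> 5"
  then have D: "has_property_D k n A"
    by simp
  \<comment> \<open>Infinite \<open>A\<close> has to be treated separately, as its
    \<open>card\<close> is 0.\<close>
  have "\<exists>B\<subseteq>A. finite B \<and> card B = 6"
  proof (cases "finite A")
    case True
    with large have "\<not> enat (card A) \<le> enat 5"
      by (simp add: ecard_def numeral_eq_enat)
    then have "6 \<le> card A"
      by simp
    then show ?thesis
      by (meson obtain_subset_with_card_n)
  next
    case False
    then show ?thesis
      by (meson infinite_arbitrarily_large)
  qed
  then obtain B where B: "B \<subseteq> A" "finite B" "card B = 6"
    by blast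
  obtain xs where xs: "set xs = B" "distinct xs"
    using finite_distinct_list[OF B(2)] by blast
  then have "length xs = 6"
    using B(3) distinct_card by fastforce
  then obtain a b c d e f where "xs = [a, b, c, d, e, f]"
    by (auto simp: numeral_eq_Suc length_Suc_conv)
  then show False
    using not_six_elements[OF assms D] xs B(1) by blast
qed

end
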